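(* Let $T$ be a bounded linear operator on a complex Banach space such that $\sigma(T)=\{1\}$. For each positive integer $n$ such that $\|T^{n+1}-T^n\|\le \dfrac{n^n}{(n+1)^{n+1}}$, we have $\|T-I\|\le \dfrac{1}{n+1}$. In particular, if $\liminf_{n\to\infty} n\,\|T^{n+1}-T^n\|<\frac1e$, then $T=I$.
   Context: All Banach spaces are complex. $\sigma(T)$ denotes the spectrum of $T$, $I$ is the identity operator, $\|\cdot\|$ is the operator norm, and $e$ is the base of the natural logarithm. *)

theory Defs
  imports "HOL-Analysis.Analysis"
begin

class complex_normed_vector = real_normed_vector +
  fixes scaleC :: "complex \<Rightarrow> 'a \<Rightarrow> 'a"  (infixr "*\<^sub>C" 75)
  assumes scaleC_add_right: "c *\<^sub>C (x + y) = c *\<^sub>C x + c *\<^sub>C y"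
    and scaleC_add_left: "(c + d) *\<^sub>C x = c *\<^sub>C x + d *\<^sub>C x"
    and scaleC_scaleC: "c *\<^sub>C (d *\<^sub>C x) = (c * d) *\<^sub>C x"
    and scaleC_of_real: "complex_of_real r *\<^sub>C x = r *\<^sub>R x"
    and norm_scaleC: "norm (c *\<^sub>C x) = cmod c * norm x"

class complex_banach = complex_normed_vector + banach

text \<open>Boundedness is that of the underlying real-linear map: the norm is the same over both
  scalar fields, so the library's \<^const>\<open>onorm\<close> is also the operator norm of a
  complex-linear operator.\<close>

definition bounded_clinear ::
    "('a::complex_normed_vector \<Rightarrow> 'b::complex_normed_vector) \<Rightarrow> bool" where
  "bounded_clinear T \<longleftrightarrow> bounded_linear T \<and> (\<forall>c x. T (c *\<^sub>C x) = c *\<^sub>C T x)"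

definition spectrum :: "('a::complex_normed_vector \<Rightarrow> 'a) \<Rightarrow> complex set" where
  "spectrum T = {c. \<not> (\<exists>S. bounded_clinear S \<and>
     (\<lambda>x. T x - c *\<^sub>C x) \<circ> S = id \<and> S \<circ> (\<lambda>x. T x - c *\<^sub>C x) = id)}"

end

theory Submission
  imports Defs "HOL-Real_Asymp.Real_Asymp"
begin

text \<open>
  Put \<open>u = I - T\<close> and \<open>b = u (1 - u)\<^sup>n\<close>, so that \<open>b = T\<^sup>n - T\<^sup>n\<^sup>+\<^sup>1\<close>. The polynomial
  \<open>x (1 - x)\<^sup>n\<close> increases on \<open>[0, 1/(n+1)]\<close> up to the value
  \<open>R = n\<^sup>n / (n+1)\<^sup>n\<^sup>+\<^sup>1\<close>, and its inverse there is the solution of \<open>x = r (1 - x)\<^sup>-\<^sup>n\<close>,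
  a power series in \<open>r\<close> with nonnegative coefficients. If \<open>u\<close> is this series evaluated at
  \<open>b\<close>, then \<open>\<parallel>b\<parallel> \<le> R\<close> gives \<open>\<parallel>u\<parallel> \<le> 1/(n+1)\<close>.

  The series itself can be avoided by the iteration \<open>X\<^sub>0 = 0\<close>, \<open>X\<^sub>j\<^sub>+\<^sub>1 = b (1 - X\<^sub>j)\<^sup>-\<^sup>n\<close>. The
  Neumann series gives \<open>\<parallel>(1 - X)\<^sup>-\<^sup>1\<parallel> \<le> 1 / (1 - \<parallel>X\<parallel>)\<close>, and \<open>1/(n+1)\<close> is a fixed point of
  \<open>x \<mapsto> R (1 - x)\<^sup>-\<^sup>n\<close>; hence all \<open>X\<^sub>j\<close> have norm at most \<open>1/(n+1)\<close>
  (lemma \<open>norm_iterate_le\<close>). The element \<open>u\<close> is a fixed point of the iteration, and everything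
  commutes, so each step multiplies the error \<open>X\<^sub>j - u\<close> by \<open>b\<close> and by a factor of bounded norm:
  \<open>X\<^sub>j - u = b\<^sup>j u c\<close> with \<open>\<parallel>c\<parallel> \<le> K\<^sup>j\<close> (lemma \<open>iterate_error\<close>). The constant \<open>K\<close> may be large,
  but \<open>b\<close> is quasinilpotent because \<open>u\<close> is. Therefore \<open>X\<^sub>j\<close> tends to \<open>u\<close>.

  That \<open>u\<close> is quasinilpotent is the spectral radius formula for the spectrum \<open>{0}\<close>. It
  is proved without integration (lemma \<open>quasinilpotent_if_resolvent_everywhere\<close>): the mean of
  \<open>(1 - z u)\<^sup>-\<^sup>1\<close> over the \<open>n\<close>-th roots of unity times \<open>z\<close> is \<open>(1 - z\<^sup>n u\<^sup>n)\<^sup>-\<^sup>1\<close>, and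
  uniform continuity of the resolvent on a disc makes these means uniformly equicontinuous in \<open>n\<close>.

  For the last claim, \<open>n R \<longlonglongrightarrow> 1/e\<close>. So the hypothesis on the limes inferior yields the norm
  condition, and with it \<open>\<parallel>u\<parallel> \<le> 1/(n+1)\<close>, for arbitrarily large \<open>n\<close>.
\<close>

section \<open>Unital complex Banach algebras\<close>

text \<open>The algebra of operators on the zero space is an instance as well; there \<open>1 = 0\<close>. This is
  why the class is built on \<open>monoid_mult\<close> instead of \<open>ring_1\<close>, and bounds the norm of the unit
  instead of fixing it.\<close>

class complex_banach_algebra = complex_banach + real_normed_algebra + monoid_mult +
  assumes scaleC_mult_left: "(c *\<^sub>C x) * y = c *\<^sub>C (x * y)"
    and scaleC_mult_right: "x * (c *\<^sub>C y) = c *\<^sub>C (x * y)"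
    and norm_one_le: "norm 1 \<le> 1"

lemma scaleC_zero_left [simp]: "0 *\<^sub>C x = (0 :: 'a::complex_normed_vector)"
  using scaleC_of_real[of 0 x] by simp

lemma scaleC_one [simp]: "1 *\<^sub>C x = (x :: 'a::complex_normed_vector)"
  using scaleC_of_real[of 1 x] by simp

lemma scaleC_zero_right [simp]: "c *\<^sub>C 0 = (0 :: 'a::complex_normed_vector)"
  using scaleC_add_right[of c 0 "0::'a"] by simp

lemma scaleC_diff_left: "(c - d) *\<^sub>C x = c *\<^sub>C x - d *\<^sub>C (x :: 'a::complex_normed_vector)"
  using scaleC_add_left[of "c - d" d x] by (simp add: algebra_simps)

lemma scaleC_diff_right: "c *\<^sub>C (x - y) = c *\<^sub>C x - c *\<^sub>C (y :: 'a::complex_normed_vector)"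
  using scaleC_add_right[of c "x - y" y] by (simp add: algebra_simps)

lemma scaleC_scaleR_commute: "c *\<^sub>C (r *\<^sub>R x) = r *\<^sub>R (c *\<^sub>C (x :: 'a::complex_normed_vector))"
  by (simp add: scaleC_of_real[symmetric] scaleC_scaleC mult.commute)

lemma bounded_linear_scaleC: "bounded_linear (\<lambda>x :: 'a::complex_normed_vector. c *\<^sub>C x)"
  by (rule bounded_linear_intro[where K = "cmod c"])
     (simp_all add: scaleC_add_right scaleC_scaleR_commute norm_scaleC mult.commute)

lemma onorm_scaleC:
  fixes f :: "'a::real_normed_vector \<Rightarrow> 'b::complex_normed_vector"
  assumes "bounded_linear f"
  shows "onorm (\<lambda>x. c *\<^sub>C f x) = cmod c * onorm f"
proof (cases "c = 0")
  case True
  then show ?thesis by (simp add: onorm_zero)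
next
  case False
  have cf: "bounded_linear (\<lambda>x. c *\<^sub>C f x)"
    by (rule bounded_linear_compose[OF bounded_linear_scaleC assms])
  have "onorm f \<le> onorm (\<lambda>x. c *\<^sub>C f x) / cmod c"
  proof (rule onorm_bound)
    show "norm (f x) \<le> onorm (\<lambda>x. c *\<^sub>C f x) / cmod c * norm x" for x
      using onorm[OF cf, of x] False by (simp add: norm_scaleC field_simps)
  qed (simp add: onorm_pos_le[OF cf])
  moreover have "onorm (\<lambda>x. c *\<^sub>C f x) \<le> cmod c * onorm f"
  proof (rule onorm_bound)
    show "norm (c *\<^sub>C f x) \<le> cmod c * onorm f * norm x" for x
      using mult_left_mono[OF onorm[OF assms, of x], of "cmod c"] by (simp add: norm_scaleC mult.assoc)
  qed (simp add: onorm_pos_le[OF assms])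
  ultimately show ?thesis using False by (simp add: field_simps)
qed

lemma scaleC_sum_left: "(\<Sum>i\<in>A. f i) *\<^sub>C x = (\<Sum>i\<in>A. f i *\<^sub>C (x :: 'a::complex_normed_vector))"
  by (induction A rule: infinite_finite_induct) (simp_all add: scaleC_add_left)

lemma scaleC_power: "(c *\<^sub>C x) ^ n = (c ^ n) *\<^sub>C (x ^ n :: 'a::complex_banach_algebra)"
  by (induction n) (simp_all add: scaleC_mult_left scaleC_mult_right scaleC_scaleC mult.commute)

lemma norm_power_le: "norm (x ^ n) \<le> norm (x :: 'a::complex_banach_algebra) ^ n"
proof (induction n)
  case 0
  show ?case using norm_one_le by simp
next
  case (Suc n)
  have "norm (x * x ^ n) \<le> norm x * norm (x ^ n)" by (rule norm_mult_ineq)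
  also have "\<dots> \<le> norm x * norm x ^ n" by (intro mult_left_mono Suc) simp
  finally show ?case by simp
qed

lemma norm_mult_le: "norm x \<le> r \<Longrightarrow> norm y \<le> s \<Longrightarrow> norm (x * y :: 'a::real_normed_algebra) \<le> r * s"
  by (meson mult_mono norm_ge_zero norm_mult_ineq order_trans)

lemma geometric_sum_mult:
  fixes x :: "'a::{ring,monoid_mult}"
  shows "(1 - x) * (\<Sum>i<n. x ^ i) = 1 - x ^ n"
proof (induction n)
  case 0
  show ?case by simp
next
  case (Suc n)
  have "(1 - x) * (\<Sum>i<Suc n. x ^ i) = (1 - x) * (\<Sum>i<n. x ^ i) + (1 - x) * x ^ n"
    by (simp add: distrib_left)
  also have "\<dots> = 1 - x ^ Suc n"
    by (simp only: Suc) (simp add: left_diff_distrib)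
  finally show ?case .
qed

lemma commutes_inverse:
  fixes x :: "'a::monoid_mult"
  assumes "x * p = 1" "p * x = 1" "y * x = x * y"
  shows "y * p = p * y"
proof -
  have "y * p = p * x * y * p" using assms by simp
  also have "\<dots> = p * (y * x) * p" using assms(3) by (simp add: mult.assoc)
  also have "\<dots> = p * y" using assms(1) by (simp add: mult.assoc)
  finally show ?thesis .
qed

lemma commutes_power:
  fixes x :: "'a::monoid_mult"
  shows "y * x = x * y \<Longrightarrow> y * x ^ n = x ^ n * y"
  by (metis power_commuting_commutes)

lemma power_mult_commuting:
  fixes x y :: "'a::monoid_mult"
  assumes "x * y = y * x"
  shows "(x * y) ^ n = x ^ n * y ^ n"
proof (induction n)
  case 0
  show ?case by simp
next
  case (Suc n)
  have "y * x ^ n = x ^ n * y" using assms by (intro commutes_power) simp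
  then show ?case using Suc by (simp add: mult.assoc) (metis mult.assoc)
qed

text \<open>The cofactor is \<open>\<Sum>i<n. x\<^sup>n\<^sup>-\<^sup>1\<^sup>-\<^sup>i y\<^sup>i\<close>, but the error estimate for the iteration below
  needs nothing about it except a bound on its norm.\<close>

lemma power_diff_cofactor:
  fixes x y :: "'a::complex_banach_algebra"
  assumes "x * y = y * x" "norm x \<le> M" "norm y \<le> M" "1 \<le> M"
  shows "\<exists>c. x ^ n - y ^ n = (x - y) * c \<and> norm c \<le> real n * M ^ n"
proof (induction n)
  case 0
  show ?case by (intro exI[of _ 0]) simp
next
  case (Suc n)
  then obtain c where c: "x ^ n - y ^ n = (x - y) * c" "norm c \<le> real n * M ^ n" by blast
  have "y * x ^ n = x ^ n * y"
    using assms(1) by (intro commutes_power) simp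
  have "x ^ Suc n - y ^ Suc n = (x - y) * x ^ n + (x ^ n - y ^ n) * y"
    using \<open>y * x ^ n = x ^ n * y\<close> by (simp add: left_diff_distrib power_commutes)
  also have "\<dots> = (x - y) * (x ^ n + c * y)"
    by (simp add: c(1) distrib_left mult.assoc)
  finally have eq: "x ^ Suc n - y ^ Suc n = (x - y) * (x ^ n + c * y)" .
  have "norm (x ^ n) \<le> M ^ n"
    using norm_power_le[of x n] power_mono[OF assms(2), of n] by simp
  moreover have "M ^ n \<le> M ^ Suc n"
    using assms(4) by (intro power_increasing) auto
  moreover have "norm (c * y) \<le> real n * M ^ n * M"
    by (intro norm_mult_le c assms)
  ultimately have "norm (x ^ n + c * y) \<le> real (Suc n) * M ^ Suc n"
    using norm_triangle_ineq[of "x ^ n" "c * y"] by (simp add: algebra_simps)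
  with eq show ?case by blast
qed

section \<open>The Neumann series\<close>

definition neumann :: "'a::complex_banach_algebra \<Rightarrow> 'a" where
  "neumann x = (\<Sum>i. x ^ i)"

lemma summable_powers:
  fixes x :: "'a::complex_banach_algebra"
  assumes "norm x < 1"
  shows "summable (\<lambda>i. x ^ i)"
proof (rule summable_comparison_test')
  show "summable (\<lambda>i. norm x ^ i)" using assms by (intro summable_geometric) simp
  show "norm (x ^ i) \<le> norm x ^ i" for i by (rule norm_power_le)
qed

lemma neumann_inverse:
  fixes x :: "'a::complex_banach_algebra"
  assumes "norm x < 1"
  shows "(1 - x) * neumann x = 1" "neumann x * (1 - x) = 1"
proof -
  note s = summable_powers[OF assms]
  have eq: "neumann x = 1 + (\<Sum>i. x ^ Suc i)"
    unfolding neumann_def using suminf_split_head[OF s] by (simp add: algebra_simps)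
  have "(\<Sum>i. x ^ Suc i) = x * neumann x"
    unfolding neumann_def using suminf_mult[OF s, of x] by simp
  with eq show "(1 - x) * neumann x = 1"
    by (simp add: left_diff_distrib)
  have "(\<Sum>i. x ^ Suc i) = neumann x * x"
    unfolding neumann_def using suminf_mult2[OF s, of x] by (simp add: power_commutes)
  with eq show "neumann x * (1 - x) = 1"
    by (simp add: right_diff_distrib)
qed

text \<open>Taking norms in \<open>p = 1 + x p\<close>, where \<open>p\<close> is the sum of the series, and solving for
  \<open>\<parallel>p\<parallel>\<close> spares a termwise estimate.\<close>

lemma norm_neumann_le:
  fixes x :: "'a::complex_banach_algebra"
  assumes "norm x \<le> r" "r < 1"
  shows "norm (neumann x) \<le> 1 / (1 - r)"
proof -
  have "neumann x = 1 + x * neumann x"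
    using neumann_inverse(1)[of x] assms by (simp add: left_diff_distrib algebra_simps)
  then have "norm (neumann x) \<le> norm (1::'a) + norm (x * neumann x)"
    by (metis norm_triangle_ineq)
  also have "\<dots> \<le> 1 + r * norm (neumann x)"
    by (intro add_mono norm_one_le norm_mult_le assms) simp
  finally show ?thesis using assms(2) by (simp add: field_simps)
qed

section \<open>Quasinilpotent elements\<close>

lemma geometric_sum_roots_of_unity:
  fixes \<omega> :: complex
  assumes "\<omega> ^ n = 1" "\<omega> ^ j \<noteq> 1"
  shows "(\<Sum>k<n. (\<omega> ^ k) ^ j) = 0"
proof -
  have "(1 - \<omega> ^ j) * (\<Sum>k<n. (\<omega> ^ j) ^ k) = 1 - (\<omega> ^ j) ^ n"
    by (rule geometric_sum_mult)
  also have "(\<omega> ^ j) ^ n = 1"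
    by (metis assms(1) mult.commute power_mult power_one)
  finally show ?thesis
    using assms(2) by (simp add: power_mult[symmetric] mult.commute)
qed

lemma primitive_root_of_unity_exists:
  assumes "n > 0"
  obtains \<omega> :: complex where "\<omega> ^ n = 1" "norm \<omega> = 1" "\<And>j. 0 < j \<Longrightarrow> j < n \<Longrightarrow> \<omega> ^ j \<noteq> 1"
proof
  let ?f = "\<lambda>k. cis (2 * pi * real k / real n)"
  have bij: "bij_betw ?f {..<n} {z. z ^ n = 1}"
    using assms by (rule Complex.bij_betw_roots_unity)
  show "cis (2 * pi / real n) ^ n = 1" using assms by (simp add: Complex.DeMoivre)
  show "norm (cis (2 * pi / real n)) = 1" by simp
  show "cis (2 * pi / real n) ^ j \<noteq> 1" if "0 < j" "j < n" for j
  proof -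
    have "?f j \<noteq> ?f 0"
      using bij that inj_onD[of ?f "{..<n}" j 0] by (auto simp: bij_betw_def)
    then show ?thesis by (simp add: Complex.DeMoivre mult.commute)
  qed
qed

text \<open>This is the partial fraction expansion of \<open>1 / (1 - z\<^sup>n a\<^sup>n)\<close>. Multiplied by
  \<open>1 - z\<^sup>n a\<^sup>n\<close>, each resolvent becomes a geometric sum, and summation over the roots of unity
  keeps only the constant term.\<close>

lemma resolvent_average:
  fixes a :: "'a::complex_banach_algebra"
  assumes F: "\<And>z. F z * (1 - z *\<^sub>C a) = 1"
    and \<omega>: "\<omega> ^ n = 1" "\<And>j. 0 < j \<Longrightarrow> j < n \<Longrightarrow> \<omega> ^ j \<noteq> 1"
    and n: "n > 0"
  shows "((1 / real n) *\<^sub>R (\<Sum>k<n. F (\<omega> ^ k * z))) * (1 - z ^ n *\<^sub>C a ^ n) = 1"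
proof -
  have average_term: "F (\<omega> ^ k * z) * (1 - z ^ n *\<^sub>C a ^ n) = (\<Sum>j<n. ((\<omega> ^ k) ^ j * z ^ j) *\<^sub>C a ^ j)" for k
  proof -
    let ?w = "\<omega> ^ k * z"
    have "?w ^ n = z ^ n"
      by (metis \<omega>(1) mult.commute mult_1 power_mult power_mult_distrib power_one)
    then have "1 - z ^ n *\<^sub>C a ^ n = 1 - (?w *\<^sub>C a) ^ n"
      by (simp add: scaleC_power)
    also have "\<dots> = (1 - ?w *\<^sub>C a) * (\<Sum>j<n. (?w *\<^sub>C a) ^ j)"
      by (rule geometric_sum_mult[symmetric])
    finally have "F ?w * (1 - z ^ n *\<^sub>C a ^ n) = (\<Sum>j<n. (?w *\<^sub>C a) ^ j)"
      using F[of ?w] by (simp add: mult.assoc[symmetric])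
    then show ?thesis by (simp add: scaleC_power power_mult_distrib)
  qed
  have coeff: "(\<Sum>k<n. (\<omega> ^ k) ^ j * z ^ j) = (if j = 0 then of_real (real n) else 0)" if "j < n" for j
    using geometric_sum_roots_of_unity[OF \<omega>(1), of j] \<omega>(2)[of j] that
    by (cases "j = 0") (simp_all add: sum_distrib_right[symmetric])
  have "(\<Sum>k<n. F (\<omega> ^ k * z)) * (1 - z ^ n *\<^sub>C a ^ n)
      = (\<Sum>k<n. \<Sum>j<n. ((\<omega> ^ k) ^ j * z ^ j) *\<^sub>C a ^ j)"
    by (simp add: sum_distrib_right average_term)
  also have "\<dots> = (\<Sum>j<n. (\<Sum>k<n. (\<omega> ^ k) ^ j * z ^ j) *\<^sub>C a ^ j)"
    by (subst sum.swap) (simp add: scaleC_sum_left)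
  also have "\<dots> = (\<Sum>j<n. if j = 0 then real n *\<^sub>R 1 else 0)"
    by (intro sum.cong refl) (auto simp: coeff scaleC_of_real simp del: of_real_of_nat_eq)
  also have "\<dots> = real n *\<^sub>R 1"
    using n by simp
  finally show ?thesis using n by simp
qed

text \<open>By the resolvent identity \<open>F z - F w = (z - w) F z a F w\<close>, the value \<open>F z\<close> is first bounded
  by \<open>2 \<parallel>F w\<parallel>\<close> near \<open>w\<close>, and then \<open>F z - F w\<close> is of order \<open>\<bar>z - w\<bar>\<close>.\<close>

lemma resolvent_continuous:
  fixes a :: "'a::complex_banach_algebra"
  assumes F: "\<And>z. F z * (1 - z *\<^sub>C a) = 1" "\<And>z. (1 - z *\<^sub>C a) * F z = 1"
  shows "continuous_on UNIV F"
proof -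
  have diff: "F z - F w = (z - w) *\<^sub>C (F z * a * F w)" for z w
  proof -
    have "F z - F w = F z * ((1 - w *\<^sub>C a) - (1 - z *\<^sub>C a)) * F w"
    proof -
      have "F z * ((1 - w *\<^sub>C a) - (1 - z *\<^sub>C a)) * F w
          = F z * ((1 - w *\<^sub>C a) * F w) - F z * (1 - z *\<^sub>C a) * F w"
        by (simp only: right_diff_distrib[of "F z"] left_diff_distrib[of _ _ "F w"] mult.assoc)
      then show ?thesis by (simp only: F) simp
    qed
    also have "(1 - w *\<^sub>C a) - (1 - z *\<^sub>C a) = (z - w) *\<^sub>C a"
      by (simp add: scaleC_diff_left)
    finally show ?thesis by (simp add: scaleC_mult_left scaleC_mult_right)
  qed
  have bound: "norm (F z - F w) \<le> cmod (z - w) * norm (F z) * (norm a * norm (F w))" for z w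
  proof -
    have "norm (F z * a * F w) \<le> norm (F z) * norm a * norm (F w)"
      by (intro norm_mult_le order_refl)
    then have "cmod (z - w) * norm (F z * a * F w) \<le> cmod (z - w) * (norm (F z) * norm a * norm (F w))"
      by (intro mult_left_mono) auto
    then show ?thesis by (simp add: diff norm_scaleC mult.assoc)
  qed
  have "isCont F w" for w
  proof -
    define m where "m = norm a * norm (F w)"
    have lim: "((\<lambda>z. cmod (z - w) * c) \<longlongrightarrow> 0) (at w)" for c
      by (intro tendsto_eq_intros) auto
    have "eventually (\<lambda>z. cmod (z - w) * m < 1 / 2) (at w)"
      using order_tendstoD(2)[OF lim[of m], of "1/2"] by simp
    then have "eventually (\<lambda>z. norm (F z - F w) \<le> cmod (z - w) * (2 * norm (F w) * m)) (at w)"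
    proof eventually_elim
      case (elim z)
      have "norm (F z) \<le> norm (F w) + cmod (z - w) * norm (F z) * m"
        using bound[of z w] norm_triangle_ineq[of "F w" "F z - F w"] by (simp add: m_def)
      also have "cmod (z - w) * norm (F z) * m \<le> 1 / 2 * norm (F z)"
        using mult_right_mono[of "cmod (z - w) * m" "1/2" "norm (F z)"] elim
        by (simp add: mult_ac)
      finally have "norm (F z) \<le> 2 * norm (F w)" by simp
      then have "cmod (z - w) * norm (F z) * m \<le> cmod (z - w) * (2 * norm (F w)) * m"
        by (intro mult_right_mono mult_left_mono) (auto simp: m_def)
      with bound[of z w] show ?case by (simp add: m_def mult.assoc)
    qed
    then have "((\<lambda>z. F z - F w) \<longlongrightarrow> 0) (at w)"
      by (rule Lim_null_comparison) (rule lim)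
    then show ?thesis by (simp add: isCont_def Lim_null[symmetric])
  qed
  then show ?thesis by (simp add: continuous_at_imp_continuous_on)
qed

text \<open>If \<open>r\<^sup>n a\<^sup>n\<close> tends to 0, then \<open>(1 - r\<^sup>n a\<^sup>n)\<^sup>-\<^sup>1\<close> is close to 1 for large \<open>n\<close>. By
  averaging, \<open>(1 - t\<^sup>n a\<^sup>n)\<^sup>-\<^sup>1\<close> differs from it by at most the oscillation of the resolvent
  between the circles of radius \<open>r\<close> and \<open>t\<close>, whatever \<open>n\<close> is. So \<open>t\<^sup>n a\<^sup>n\<close> stays bounded, and
  \<open>s\<^sup>n a\<^sup>n\<close> tends to 0 for \<open>s < t\<close>. The admissible distance \<open>t - r\<close> depends only on the disc
  of uniform continuity, so that finitely many such steps lead from radius 0 to \<open>K\<close>.\<close>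

lemma quasinilpotent_if_resolvent_everywhere:
  fixes a :: "'a::complex_banach_algebra"
  assumes F: "\<And>z. F z * (1 - z *\<^sub>C a) = 1" "\<And>z. (1 - z *\<^sub>C a) * F z = 1"
    and "0 \<le> K"
  shows "(\<lambda>n. K ^ n * norm (a ^ n)) \<longlonglongrightarrow> 0"
proof -
  have "uniformly_continuous_on (cball 0 (K + 1)) F"
    using resolvent_continuous[OF F] continuous_on_subset
    by (intro compact_uniformly_continuous) auto
  then obtain d where d: "d > 0"
      "\<And>z w. norm z \<le> K + 1 \<Longrightarrow> norm w \<le> K + 1 \<Longrightarrow> dist z w < d \<Longrightarrow> dist (F z) (F w) < 1 / 4"
    unfolding uniformly_continuous_on_def by (metis mem_cball_0 zero_less_divide_1_iff zero_less_numeral)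
  \<comment> \<open>The closeness \<open>1/4\<close> of \<open>F\<close> and \<open>\<parallel>y r\<parallel> < 1/5\<close> are chosen to give \<open>\<parallel>G t - 1\<parallel> \<le> 1/2\<close>, from
    which \<open>\<parallel>y t\<parallel> \<le> 1\<close> follows.\<close>
  have step: "(\<lambda>n. s ^ n * norm (a ^ n)) \<longlonglongrightarrow> 0"
    if r: "0 \<le> r" "(\<lambda>n. r ^ n * norm (a ^ n)) \<longlonglongrightarrow> 0"
      and s: "0 \<le> s" "s < t" "r \<le> t" "t < r + d" "t \<le> K + 1" for r s t
  proof -
    have "eventually (\<lambda>n. r ^ n * norm (a ^ n) < 1 / 5) sequentially"
      using order_tendstoD(2)[OF r(2), of "1/5"] by simp
    then have "eventually (\<lambda>n. t ^ n * norm (a ^ n) \<le> 1) sequentially"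
      using eventually_gt_at_top[of 0]
    proof eventually_elim
      case (elim n)
      obtain \<omega> :: complex where \<omega>: "\<omega> ^ n = 1" "norm \<omega> = 1"
          "\<And>j. 0 < j \<Longrightarrow> j < n \<Longrightarrow> \<omega> ^ j \<noteq> 1"
        using primitive_root_of_unity_exists elim(2) by metis
      define G where "G q = (1 / real n) *\<^sub>R (\<Sum>k<n. F (\<omega> ^ k * complex_of_real q))" for q
      define y where "y q = (q ^ n) *\<^sub>R a ^ n" for q
      have norm_y: "norm (y q) = q ^ n * norm (a ^ n)" if "0 \<le> q" for q
        using that by (simp add: y_def)
      have G: "G q = 1 + G q * y q" for q
      proof -
        have "G q * (1 - y q) = 1"
          using resolvent_average[OF F(1) \<omega>(1,3) elim(2), of "complex_of_real q"]
          by (simp add: G_def y_def of_real_power[symmetric] scaleC_of_real del: of_real_power)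
        then show ?thesis by (simp add: right_diff_distrib algebra_simps)
      qed
      have "norm (G t - G r) \<le> 1 / 4"
      proof -
        have "norm (F (\<omega> ^ k * complex_of_real t) - F (\<omega> ^ k * complex_of_real r)) \<le> 1 / 4" for k
        proof -
          have "dist (\<omega> ^ k * complex_of_real t) (\<omega> ^ k * complex_of_real r) = \<bar>t - r\<bar>"
            by (simp add: dist_norm right_diff_distrib[symmetric] norm_mult norm_power \<omega>(2)
                of_real_diff[symmetric] del: of_real_diff)
          then have "dist (F (\<omega> ^ k * complex_of_real t)) (F (\<omega> ^ k * complex_of_real r)) < 1 / 4"
            using r s by (intro d(2)) (auto simp: norm_mult norm_power \<omega>(2))
          then show ?thesis by (simp add: dist_norm)
        qed
        then have "norm (\<Sum>k<n. F (\<omega> ^ k * complex_of_real t) - F (\<omega> ^ k * complex_of_real r))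
            \<le> real n * (1 / 4)"
          using sum_norm_bound[of "{..<n}" "\<lambda>k. F (\<omega> ^ k * complex_of_real t) - F (\<omega> ^ k * complex_of_real r)" "1/4"]
          by simp
        then have "norm ((1 / real n) *\<^sub>R
            (\<Sum>k<n. F (\<omega> ^ k * complex_of_real t) - F (\<omega> ^ k * complex_of_real r))) \<le> 1 / 4"
          using elim(2) by (simp add: field_simps)
        then show ?thesis
          by (simp add: G_def sum_subtractf scaleR_diff_right)
      qed
      moreover have "norm (G r - 1) \<le> 1 / 4"
      proof -
        have "G r - 1 = y r + (G r - 1) * y r"
          using G[of r] by (simp add: left_diff_distrib algebra_simps)
        then have "norm (G r - 1) \<le> norm (y r) + norm ((G r - 1) * y r)"
          by (metis norm_triangle_ineq)
        also have "\<dots> \<le> 1 / 5 + norm (G r - 1) * (1 / 5)"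
          using elim(1) norm_y[of r] r(1) by (intro add_mono norm_mult_le) auto
        finally show ?thesis by simp
      qed
      ultimately have half: "norm (G t - 1) \<le> 1 / 2"
        using norm_triangle_ineq[of "G t - G r" "G r - 1"] by simp
      have "y t = (G t - 1) - (G t - 1) * y t"
        using G[of t] by (simp add: left_diff_distrib algebra_simps)
      then have "norm (y t) \<le> norm (G t - 1) + norm ((G t - 1) * y t)"
        by (metis norm_triangle_ineq4)
      also have "\<dots> \<le> 1 / 2 + 1 / 2 * norm (y t)"
        by (intro add_mono norm_mult_le half order_refl)
      finally show ?case using norm_y[of t] s by simp
    qed
    then have "eventually (\<lambda>n. norm (s ^ n * norm (a ^ n)) \<le> (s / t) ^ n) sequentially"
    proof eventually_elim
      case (elim n)
      have "s ^ n * norm (a ^ n) = (s / t) ^ n * (t ^ n * norm (a ^ n))"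
        using s by (simp add: power_divide)
      also have "\<dots> \<le> (s / t) ^ n"
        using elim s by (intro mult_left_le) auto
      finally show ?case using s by simp
    qed
    moreover have "(\<lambda>n. (s / t) ^ n) \<longlonglongrightarrow> 0"
      using s by (intro LIMSEQ_realpow_zero) auto
    ultimately show ?thesis
      by (rule Lim_null_comparison)
  qed
  \<comment> \<open>A step passes through the intermediate radius \<open>t = r + 2 h\<close> to reach \<open>r + h\<close>, so \<open>2 h\<close> has
    to stay below \<open>d\<close> and inside the margin 1 of the disc.\<close>
  define h where "h = min (d / 3) (1 / 2)"
  have h: "h > 0" "2 * h < d" "2 * h \<le> 1" using d(1) by (auto simp: h_def)
  have "(\<lambda>n. (min (real m * h) K) ^ n * norm (a ^ n)) \<longlonglongrightarrow> 0" for m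
  proof (induction m)
    case 0
    have "eventually (\<lambda>n. (0::real) = 0 ^ n * norm (a ^ n)) sequentially"
      using eventually_gt_at_top[of 0] by eventually_elim (simp add: power_0_left)
    then have "(\<lambda>n. (0::real) ^ n * norm (a ^ n)) \<longlonglongrightarrow> 0"
      by (rule Lim_transform_eventually[OF tendsto_const])
    then show ?case using assms(3) by simp
  next
    case (Suc m)
    show ?case
      by (rule step[OF _ Suc, of _ "min (real m * h) K + 2 * h"])
         (use h assms(3) in \<open>auto simp: algebra_simps min_def\<close>)
  qed
  moreover obtain m :: nat where "K \<le> real m * h"
    using reals_Archimedean3[OF h(1)] less_imp_le by metis
  ultimately show ?thesis by (metis min.absorb2)
qed

section \<open>Inverting \<open>u \<mapsto> u (1 - u)\<^sup>n\<close>\<close>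

text \<open>Picard iteration for the equation \<open>u = b (1 - u)\<^sup>-\<^sup>n\<close>.\<close>

primrec iterate :: "'a::complex_banach_algebra \<Rightarrow> nat \<Rightarrow> nat \<Rightarrow> 'a" where
  "iterate b n 0 = 0"
| "iterate b n (Suc j) = b * neumann (iterate b n j) ^ n"

text \<open>With \<open>R = n\<^sup>n / (n+1)\<^sup>n\<^sup>+\<^sup>1\<close> the scalar map \<open>x \<mapsto> R / (1 - x)\<^sup>n\<close> fixes \<open>1/(n+1)\<close>, which
  is what carries the bound through the induction.\<close>

lemma norm_iterate_le:
  fixes b :: "'a::complex_banach_algebra"
  assumes "n \<ge> 1" "norm b \<le> real n ^ n / real (n + 1) ^ (n + 1)"
  shows "norm (iterate b n j) \<le> 1 / real (n + 1)"
proof (induction j)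
  case 0
  show ?case by simp
next
  case (Suc j)
  have "1 / (1 - 1 / real (n + 1)) = real (n + 1) / real n"
    using assms(1) by (simp add: field_simps)
  then have "norm (neumann (iterate b n j)) \<le> real (n + 1) / real n"
    using norm_neumann_le[OF Suc] assms(1) by simp
  then have "norm (neumann (iterate b n j) ^ n) \<le> (real (n + 1) / real n) ^ n"
    by (meson norm_ge_zero norm_power_le order_trans power_mono)
  then have "norm (iterate b n (Suc j)) \<le>
      real n ^ n / real (n + 1) ^ (n + 1) * (real (n + 1) / real n) ^ n"
    unfolding iterate.simps by (rule norm_mult_le[OF assms(2)])
  also have "\<dots> = 1 / real (n + 1)"
    using assms(1) by (simp add: power_divide del: of_nat_add)
  finally show ?case .
qed

lemma commutes_iterate:
  fixes b :: "'a::complex_banach_algebra"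
  assumes "\<And>j. norm (iterate b n j) < 1" "y * b = b * y"
  shows "y * iterate b n j = iterate b n j * y"
proof (induction j)
  case 0
  show ?case by simp
next
  case (Suc j)
  have "y * neumann (iterate b n j) = neumann (iterate b n j) * y"
    by (rule commutes_inverse[OF neumann_inverse[OF assms(1)]])
       (simp add: Suc left_diff_distrib right_diff_distrib)
  then have "y * neumann (iterate b n j) ^ n = neumann (iterate b n j) ^ n * y"
    by (rule commutes_power)
  then show ?case using assms(2) by (metis iterate.simps(2) mult.assoc)
qed

text \<open>Write \<open>p\<close> for the inverse of \<open>1 - X\<close>, where \<open>X\<close> is the current iterate. Then
  \<open>b p\<^sup>n - u = b (p\<^sup>n - q\<^sup>n)\<close>, and \<open>p\<^sup>n - q\<^sup>n\<close> is a multiple of \<open>p - q = p (X - u) q\<close>. So the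
  error picks up one more factor \<open>b\<close> in each step, and the other new factors are collected in
  \<open>c\<close>. Only \<open>p\<close> has to be moved past \<open>b\<^sup>j u\<close> for this; it commutes with whatever commutes with
  \<open>b\<close>.\<close>

lemma iterate_error:
  fixes u :: "'a::complex_banach_algebra"
  assumes q: "(1 - u) * q = 1" "q * (1 - u) = 1"
    and b: "b = u * (1 - u) ^ n"
    and r: "\<And>j. norm (iterate b n j) \<le> r" "r < 1"
    and M: "norm q \<le> M" "1 / (1 - r) \<le> M" "1 \<le> M"
  shows "\<exists>c. iterate b n j - u = b ^ j * u * c \<and> norm c \<le> (M * M * (real n * M ^ n)) ^ j"
proof (induction j)
  case 0
  show ?case by (intro exI[of _ "-1"]) (simp add: norm_one_le)
next
  case (Suc j)
  define X where "X = iterate b n j"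
  define p where "p = neumann X"
  obtain c where c: "X - u = b ^ j * u * c" "norm c \<le> (M * M * (real n * M ^ n)) ^ j"
    using Suc X_def by blast
  have X1: "norm X < 1" using r X_def by (metis le_less_trans)
  have p: "(1 - X) * p = 1" "p * (1 - X) = 1"
    using neumann_inverse[OF X1] by (simp_all add: p_def)
  have norm_p: "norm p \<le> M"
    using norm_neumann_le[of X r] r M X_def p_def by (meson order_trans)
  have comm_p: "y * p = p * y" if "y * b = b * y" for y
  proof (rule commutes_inverse[OF p])
    have "y * X = X * y" unfolding X_def
      by (rule commutes_iterate) (use r that in \<open>auto intro: le_less_trans\<close>)
    then show "y * (1 - X) = (1 - X) * y"
      by (simp add: left_diff_distrib right_diff_distrib)
  qed
  have u1: "u * (1 - u) ^ n = (1 - u) ^ n * u"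
    by (rule commutes_power) (simp add: left_diff_distrib right_diff_distrib)
  then have ub: "u * b = b * u" by (metis b mult.assoc)
  have "b * (1 - u) = (1 - u) * b" using ub by (simp add: left_diff_distrib right_diff_distrib)
  then have qb: "q * b = b * q"
    using commutes_inverse[OF q, of b] by simp
  have "u = b * q ^ n"
  proof -
    have "(1 - u) ^ n * q ^ n = ((1 - u) * q) ^ n"
      by (rule power_mult_commuting[symmetric]) (simp add: q)
    then show ?thesis by (simp add: b mult.assoc q)
  qed
  obtain e where e: "p ^ n - q ^ n = (p - q) * e" "norm e \<le> real n * M ^ n"
    using power_diff_cofactor[of p q M n] comm_p[OF qb] norm_p M by metis
  have "p - q = p * ((1 - u) - (1 - X)) * q"
  proof -
    have "p * ((1 - u) - (1 - X)) * q = p * ((1 - u) * q) - p * (1 - X) * q"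
      by (simp only: right_diff_distrib[of p] left_diff_distrib[of _ _ q] mult.assoc)
    then show ?thesis by (simp only: p q) simp
  qed
  then have pq: "p - q = p * (X - u) * q" by simp
  have bp: "b ^ Suc j * u * p = p * (b ^ Suc j * u)"
    by (rule comm_p) (metis mult.assoc power_commutes power_Suc ub)
  have "iterate b n (Suc j) - u = b * (p ^ n - q ^ n)"
    using \<open>u = b * q ^ n\<close> by (simp add: p_def X_def right_diff_distrib)
  also have "\<dots> = b * (p * (b ^ j * u * c) * q) * e"
    by (simp add: e pq c(1) mult.assoc)
  also have "\<dots> = p * (b ^ Suc j * u) * c * q * e"
    using comm_p[of b] by (simp add: mult.assoc[symmetric])
  also have "\<dots> = b ^ Suc j * u * (p * (c * q) * e)"
    by (subst bp[symmetric]) (simp add: mult.assoc)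
  finally have eq: "iterate b n (Suc j) - u = b ^ Suc j * u * (p * (c * q) * e)" .
  have "norm (p * (c * q) * e) \<le> M * ((M * M * (real n * M ^ n)) ^ j * M) * (real n * M ^ n)"
    by (intro norm_mult_le norm_p c(2) M(1) e(2))
  also have "\<dots> = (M * M * (real n * M ^ n)) ^ Suc j"
    by (simp add: mult_ac)
  finally show ?case using eq by blast
qed

text \<open>The assumptions say that \<open>u\<close> has spectrum contained in \<open>{0}\<close>. In the limit \<open>j \<rightarrow> \<infinity>\<close> the error
  of the iterates disappears, since \<open>\<parallel>b\<^sup>j\<parallel> K\<^sup>j \<le> \<parallel>u\<^sup>j\<parallel> (N K)\<^sup>j\<close> with \<open>N = \<parallel>(1 - u)\<^sup>n\<parallel>\<close>.\<close>

theorem quasinilpotent_norm_le: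
  fixes u :: "'a::complex_banach_algebra"
  assumes F: "\<And>z. F z * (1 - z *\<^sub>C u) = 1" "\<And>z. (1 - z *\<^sub>C u) * F z = 1"
    and n: "n \<ge> 1" "norm (u * (1 - u) ^ n) \<le> real n ^ n / real (n + 1) ^ (n + 1)"
  shows "norm u \<le> 1 / real (n + 1)"
proof -
  define b where "b = u * (1 - u) ^ n"
  define M where "M = max (norm (F 1)) (max 1 (1 / (1 - 1 / real (n + 1))))"
  define K where "K = M * M * (real n * M ^ n)"
  define N where "N = norm ((1 - u) ^ n)"
  have M1: "1 \<le> M" by (simp add: M_def)
  have K0: "0 \<le> K" using M1 by (simp add: K_def)
  have it: "norm (iterate b n j) \<le> 1 / real (n + 1)" for j
    using norm_iterate_le[of n b] n by (simp add: b_def)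
  have "norm u \<le> 1 / real (n + 1) + (N * K) ^ j * norm (u ^ j) * norm u" for j
  proof -
    obtain c where c: "iterate b n j - u = b ^ j * u * c" "norm c \<le> K ^ j"
    proof -
      have "\<exists>c. iterate b n j - u = b ^ j * u * c \<and> norm c \<le> (M * M * (real n * M ^ n)) ^ j"
      proof (rule iterate_error)
        show "(1 - u) * F 1 = 1" "F 1 * (1 - u) = 1" using F[of 1] by simp_all
        show "1 / real (n + 1) < 1" using n(1) by simp
      qed (rule it b_def M1 | simp add: M_def)+
      then show ?thesis using that unfolding K_def by blast
    qed
    have "u * (1 - u) ^ n = (1 - u) ^ n * u"
      by (rule commutes_power) (simp add: left_diff_distrib right_diff_distrib)
    then have "b ^ j = u ^ j * ((1 - u) ^ n) ^ j"
      unfolding b_def by (rule power_mult_commuting)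
    also have "norm \<dots> \<le> norm (u ^ j) * N ^ j"
      unfolding N_def by (intro norm_mult_le norm_power_le order_refl)
    finally have "norm (b ^ j * u * c) \<le> norm (u ^ j) * N ^ j * norm u * K ^ j"
      by (intro norm_mult_le c(2) order_refl)
    moreover have "norm u \<le> norm (iterate b n j) + norm (iterate b n j - u)"
      by (metis norm_triangle_sub norm_minus_commute)
    ultimately show ?thesis
      using it[of j] c(1) by (simp add: power_mult_distrib mult_ac)
  qed
  moreover have "(\<lambda>j. 1 / real (n + 1) + (N * K) ^ j * norm (u ^ j) * norm u)
      \<longlonglongrightarrow> 1 / real (n + 1) + 0 * norm u"
    by (intro tendsto_intros quasinilpotent_if_resolvent_everywhere[OF F]) (use K0 in \<open>simp add: N_def\<close>)
  ultimately have "norm u \<le> 1 / real (n + 1) + 0 * norm u"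
    by (intro LIMSEQ_le_const) auto
  then show ?thesis by simp
qed

section \<open>The Banach algebra of bounded operators\<close>

typedef (overloaded) 'a op = "{T :: 'a::complex_banach \<Rightarrow> 'a. bounded_clinear T}"
  morphisms op_apply Op
  by (auto simp: bounded_clinear_def intro!: exI[of _ "\<lambda>_. 0"])

setup_lifting type_definition_op

lemma bounded_clinear_op_apply: "bounded_clinear (op_apply A)"
  using op_apply by auto

lemma bounded_linear_op_apply: "bounded_linear (op_apply A)"
  using bounded_clinear_op_apply by (auto simp: bounded_clinear_def)

lemma op_apply_scaleC: "op_apply A (c *\<^sub>C x) = c *\<^sub>C op_apply A x"
  using bounded_clinear_op_apply by (auto simp: bounded_clinear_def)

lemma op_eqI: "(\<And>x. op_apply A x = op_apply B x) \<Longrightarrow> A = B"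
  by transfer auto

instantiation op :: (complex_banach) complex_normed_vector
begin

lift_definition norm_op :: "'a op \<Rightarrow> real" is onorm .

lift_definition minus_op :: "'a op \<Rightarrow> 'a op \<Rightarrow> 'a op" is "\<lambda>f g x. f x - g x"
  by (auto simp: bounded_clinear_def scaleC_diff_right intro: bounded_linear_sub)

lift_definition uminus_op :: "'a op \<Rightarrow> 'a op" is "\<lambda>f x. - f x"
  by (auto simp: bounded_clinear_def intro: bounded_linear_minus)
     (metis scaleC_diff_right scaleC_zero_right diff_0)

lift_definition zero_op :: "'a op" is "\<lambda>x. 0"
  by (auto simp: bounded_clinear_def)

lift_definition plus_op :: "'a op \<Rightarrow> 'a op \<Rightarrow> 'a op" is "\<lambda>f g x. f x + g x"
  by (auto simp: bounded_clinear_def scaleC_add_right intro: bounded_linear_add)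

lift_definition scaleR_op :: "real \<Rightarrow> 'a op \<Rightarrow> 'a op" is "\<lambda>r f x. r *\<^sub>R f x"
  by (auto simp: bounded_clinear_def scaleC_scaleR_commute intro: bounded_linear_const_scaleR)

lift_definition scaleC_op :: "complex \<Rightarrow> 'a op \<Rightarrow> 'a op" is "\<lambda>c f x. c *\<^sub>C f x"
  by (auto simp: bounded_clinear_def scaleC_scaleC mult.commute
      intro: bounded_linear_compose[OF bounded_linear_scaleC])

definition dist_op :: "'a op \<Rightarrow> 'a op \<Rightarrow> real" where
  "dist_op A B = norm (A - B)"

definition uniformity_op :: "('a op \<times> 'a op) filter" where
  "uniformity_op = (INF e\<in>{0 <..}. principal {(A, B). dist A B < e})"

definition open_op :: "'a op set \<Rightarrow> bool" where
  "open_op S = (\<forall>A\<in>S. \<forall>\<^sub>F (A', B) in uniformity. A' = A \<longrightarrow> B \<in> S)"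

definition sgn_op :: "'a op \<Rightarrow> 'a op" where
  "sgn_op A = inverse (norm A) *\<^sub>R A"

instance
proof
  fix A B C :: "'a op" and r s :: real and c d :: complex
  show "A + B + C = A + (B + C)" "A + B = B + A" "0 + A = A" "- A + A = 0" "A - B = A + - B"
    by (transfer, simp add: algebra_simps)+
  show "r *\<^sub>R (A + B) = r *\<^sub>R A + r *\<^sub>R B" "(r + s) *\<^sub>R A = r *\<^sub>R A + s *\<^sub>R A"
      "r *\<^sub>R s *\<^sub>R A = (r * s) *\<^sub>R A" "1 *\<^sub>R A = A"
    by (transfer, simp add: algebra_simps)+
  show "sgn A = inverse (norm A) *\<^sub>R A" "dist A B = norm (A - B)"
    by (simp_all add: sgn_op_def dist_op_def)
  show "uniformity = (INF e\<in>{0 <..}. principal {(x :: 'a op, y). dist x y < e})"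
    by (rule uniformity_op_def)
  show "open U = (\<forall>x\<in>U. \<forall>\<^sub>F (x', y) in uniformity. x' = x \<longrightarrow> y \<in> U)" for U :: "'a op set"
    by (rule open_op_def)
  show "norm A = 0 \<longleftrightarrow> A = 0"
    by transfer (auto simp: bounded_clinear_def onorm_eq_0)
  show "norm (A + B) \<le> norm A + norm B"
    by transfer (auto simp: bounded_clinear_def intro: onorm_triangle)
  show "norm (r *\<^sub>R A) = \<bar>r\<bar> * norm A"
    by transfer (auto simp: bounded_clinear_def onorm_scaleR)
  show "c *\<^sub>C (A + B) = c *\<^sub>C A + c *\<^sub>C B" "(c + d) *\<^sub>C A = c *\<^sub>C A + d *\<^sub>C A"
      "c *\<^sub>C d *\<^sub>C A = (c * d) *\<^sub>C A" "complex_of_real r *\<^sub>C A = r *\<^sub>R A"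
    by (transfer, simp add: scaleC_add_right scaleC_add_left scaleC_scaleC scaleC_of_real)+
  show "norm (c *\<^sub>C A) = cmod c * norm A"
    by transfer (simp add: bounded_clinear_def onorm_scaleC)
qed

end

text \<open>Completeness is inherited from the real operators: complex linearity survives pointwise
  limits, so the complex-linear operators are a closed subspace.\<close>

instance op :: (complex_banach) complex_banach
proof
  fix X :: "nat \<Rightarrow> 'a op"
  assume "Cauchy X"
  define Y where "Y n = Blinfun (op_apply (X n))" for n
  have Y: "blinfun_apply (Y n) = op_apply (X n)" for n
    by (simp add: Y_def bounded_linear_Blinfun_apply bounded_linear_op_apply)
  have "norm (Y m - Y n) = norm (X m - X n)" for m n
    by (simp add: norm_blinfun.rep_eq norm_op.rep_eq minus_blinfun.rep_eq minus_op.rep_eq Y)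
  then have "Cauchy Y"
    using \<open>Cauchy X\<close> by (simp add: Cauchy_def dist_norm)
  then obtain L where L: "Y \<longlonglongrightarrow> L"
    using Cauchy_convergent_iff convergent_def by blast
  have lim: "(\<lambda>n. op_apply (X n) x) \<longlonglongrightarrow> blinfun_apply L x" for x
    using blinfun.tendsto[OF L tendsto_const, of x] by (simp add: Y)
  have "blinfun_apply L (c *\<^sub>C x) = c *\<^sub>C blinfun_apply L x" for c x
  proof (rule LIMSEQ_unique[OF lim])
    have "(\<lambda>n. c *\<^sub>C op_apply (X n) x) \<longlonglongrightarrow> c *\<^sub>C blinfun_apply L x"
      by (rule bounded_linear.tendsto[OF bounded_linear_scaleC lim])
    then show "(\<lambda>n. op_apply (X n) (c *\<^sub>C x)) \<longlonglongrightarrow> c *\<^sub>C blinfun_apply L x"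
      by (simp only: op_apply_scaleC)
  qed
  then have "bounded_clinear (blinfun_apply L)"
    by (simp add: bounded_clinear_def blinfun.bounded_linear_right)
  then have "op_apply (Op (blinfun_apply L)) = blinfun_apply L"
    by (simp add: Op_inverse)
  then have "norm (X n - Op (blinfun_apply L)) = norm (Y n - L)" for n
    by (simp add: norm_blinfun.rep_eq norm_op.rep_eq minus_blinfun.rep_eq minus_op.rep_eq Y)
  moreover have "(\<lambda>n. norm (Y n - L)) \<longlonglongrightarrow> 0"
    using L by (simp add: LIM_zero tendsto_norm_zero)
  ultimately have "(\<lambda>n. norm (X n - Op (blinfun_apply L))) \<longlonglongrightarrow> 0"
    by simp
  then have "X \<longlonglongrightarrow> Op (blinfun_apply L)"
    by (rule LIM_zero_cancel[OF tendsto_norm_zero_cancel])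
  then show "convergent X" by (auto simp: convergent_def)
qed

instantiation op :: (complex_banach) complex_banach_algebra
begin

lift_definition times_op :: "'a op \<Rightarrow> 'a op \<Rightarrow> 'a op" is "\<lambda>f g x. f (g x)"
  by (auto simp: bounded_clinear_def intro: bounded_linear_compose)

lift_definition one_op :: "'a op" is "\<lambda>x. x"
  by (simp add: bounded_clinear_def)

instance
proof
  fix A B C :: "'a op" and r :: real and c :: complex
  show "A * B * C = A * (B * C)" "1 * A = A" "A * 1 = A" "(A + B) * C = A * C + B * C"
      "(r *\<^sub>R A) * B = r *\<^sub>R (A * B)" "(c *\<^sub>C A) * B = c *\<^sub>C (A * B)"
    by (transfer, simp)+
  show "A * (B + C) = A * B + A * C" "A * (r *\<^sub>R B) = r *\<^sub>R (A * B)"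
    by (transfer, auto simp: bounded_clinear_def linear_simps)+
  show "A * (c *\<^sub>C B) = c *\<^sub>C (A * B)"
    by transfer (auto simp: bounded_clinear_def)
  show "norm (A * B) \<le> norm A * norm B"
    by transfer (use onorm_compose in \<open>auto simp: bounded_clinear_def o_def\<close>)
  show "norm (1 :: 'a op) \<le> 1"
    by transfer (rule onorm_bound, simp_all)
qed

end

lemma op_apply_power: "op_apply (A ^ n) = op_apply A ^^ n"
  by (induction n) (auto simp: one_op.rep_eq times_op.rep_eq fun_eq_iff)

theorem theorem2p2:
  fixes T :: "'a::complex_banach \<Rightarrow> 'a"
  assumes "bounded_clinear T"
    and "spectrum T = {1}"
  shows "(\<forall>n::nat. n \<ge> 1 \<longrightarrow>
            onorm (\<lambda>x. (T ^^ (n + 1)) x - (T ^^ n) x) \<le> real n ^ n / real (n + 1) ^ (n + 1) \<longrightarrow>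
            onorm (\<lambda>x. T x - x) \<le> 1 / real (n + 1))
       \<and> (liminf (\<lambda>n. ereal (real n * onorm (\<lambda>x. (T ^^ (n + 1)) x - (T ^^ n) x)))
              < ereal (1 / exp 1) \<longrightarrow>
          T = id)"
proof -
  define A where "A = Op T"
  have A: "op_apply A = T" by (simp add: A_def Op_inverse assms(1))
  define u where "u = 1 - A"
  define d where "d n = onorm (\<lambda>x. (T ^^ (n + 1)) x - (T ^^ n) x)" for n
  \<comment> \<open>For \<open>z \<noteq> 0\<close> one has \<open>1 - z u = z (T - c)\<close> with \<open>c = 1 - 1/z \<noteq> 1\<close>, and \<open>c\<close> is not in the
    spectrum.\<close>
  have "\<exists>G. G * (1 - z *\<^sub>C u) = 1 \<and> (1 - z *\<^sub>C u) * G = 1" for z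
  proof (cases "z = 0")
    case True
    then show ?thesis by (intro exI[of _ 1]) simp
  next
    case False
    define c where "c = 1 - 1 / z"
    have "c \<notin> spectrum T" using False by (simp add: assms(2) c_def)
    then obtain S where S: "bounded_clinear S" "(\<lambda>x. T x - c *\<^sub>C x) \<circ> S = id"
        "S \<circ> (\<lambda>x. T x - c *\<^sub>C x) = id"
      unfolding spectrum_def by blast
    have OpS: "op_apply (Op S) = S" by (simp add: Op_inverse S(1))
    have inv: "(A - c *\<^sub>C 1) * Op S = 1" "Op S * (A - c *\<^sub>C 1) = 1"
      using S(2,3) by (auto intro!: op_eqI simp: times_op.rep_eq minus_op.rep_eq one_op.rep_eq
          scaleC_op.rep_eq A OpS fun_eq_iff)
    have "z * c = z - 1" using False by (simp add: c_def right_diff_distrib)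
    then have "1 - z *\<^sub>C u = z *\<^sub>C (A - c *\<^sub>C 1)"
      by (simp add: u_def scaleC_diff_right scaleC_diff_left scaleC_scaleC)
    then have "(1 / z) *\<^sub>C Op S * (1 - z *\<^sub>C u) = 1 \<and> (1 - z *\<^sub>C u) * (1 / z) *\<^sub>C Op S = 1"
      using False by (simp add: scaleC_mult_left scaleC_mult_right scaleC_scaleC inv)
    then show ?thesis by blast
  qed
  then obtain F where F: "\<And>z. F z * (1 - z *\<^sub>C u) = 1" "\<And>z. (1 - z *\<^sub>C u) * F z = 1"
    by metis
  have norm_u: "norm u = onorm (\<lambda>x. T x - x)"
    using norm_minus_commute[of 1 A]
    by (simp add: u_def norm_op.rep_eq minus_op.rep_eq one_op.rep_eq A)
  have "u * (1 - u) ^ n = - (A ^ (n + 1) - A ^ n)" for n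
    by (simp add: u_def left_diff_distrib)
  then have "norm (u * (1 - u) ^ n) = norm (A ^ (n + 1) - A ^ n)" for n
    by (metis norm_minus_cancel)
  then have norm_d: "norm (u * (1 - u) ^ n) = d n" for n
    unfolding d_def by (simp only: norm_op.rep_eq minus_op.rep_eq op_apply_power A)
  have bound: "norm u \<le> 1 / real (n + 1)"
    if "n \<ge> 1" "d n \<le> real n ^ n / real (n + 1) ^ (n + 1)" for n
    using quasinilpotent_norm_le[OF F that(1)] that(2) norm_d by simp
  have "T = id" if low: "liminf (\<lambda>n. ereal (real n * d n)) < ereal (1 / exp 1)"
  proof -
    obtain y where y: "liminf (\<lambda>n. ereal (real n * d n)) < ereal y" "y < 1 / exp 1"
      using ereal_dense2[OF low] by auto
    have "(\<lambda>n::nat. real n * (real n ^ n / real (n + 1) ^ (n + 1))) \<longlonglongrightarrow> inverse (exp 1)"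
      by real_asymp
    then have ev: "eventually (\<lambda>n::nat. y < real n * (real n ^ n / real (n + 1) ^ (n + 1))) sequentially"
      by (rule order_tendstoD(1)) (use y(2) in \<open>simp add: inverse_eq_divide\<close>)
    have "norm u \<le> e" if "e > 0" for e
    proof -
      have "\<not> eventually (\<lambda>n. ereal y \<le> ereal (real n * d n)) sequentially"
        using Liminf_bounded y(1) by (metis leD)
      then have "frequently (\<lambda>n. real n * d n < y) sequentially"
        by (simp add: frequently_def not_less)
      moreover have "eventually (\<lambda>n. 1 / real (n + 1) < e) sequentially"
        using that by real_asymp
      ultimately obtain n where n: "real n * d n < y" "1 / real (n + 1) < e" "n \<ge> 1"
          "y < real n * (real n ^ n / real (n + 1) ^ (n + 1))"
        using frequently_ex[OF frequently_eventually_conj[OF _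
            eventually_conj[OF ev eventually_conj[OF _ eventually_ge_at_top[of 1]]]]]
        by blast
      then have "real n * d n \<le> real n * (real n ^ n / real (n + 1) ^ (n + 1))"
        by linarith
      then have "d n \<le> real n ^ n / real (n + 1) ^ (n + 1)"
        using n(3) by (subst (asm) mult_le_cancel_left_pos) auto
      with bound[OF n(3)] n(2) show ?thesis by linarith
    qed
    then have "norm u \<le> 0"
      using field_le_epsilon[of "norm u" 0] by simp
    then have "A = 1" by (simp add: u_def)
    then have "T = op_apply 1" using A by simp
    then show ?thesis by (simp add: one_op.rep_eq id_def)
  qed
  then show ?thesis
    using bound by (simp add: norm_u d_def)
qed

end
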